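(* Let $d \geq 2$ and let $S$ be any set in $\mathrm{Sym}(d)$. Given $k \in \{0, \dots, d\}$, let $D_S(k)$ be the number of permutations in $S$ that fix exactly $k$ points of $\{1,\dots,d\}$, and define the polynomial $$f_S(x) := \sum_{k = 1}^d \frac{D_S(k)}{\# S} \left(1 - (1-x)^k\right).$$ Then: 1. $\mathrm{FPP}(W_S)$ equals the largest fixed point of $f_S$ in $[0,1]$. 2. $\mathrm{FPP}(W_S)$ is the solution of a polynomial of degree at most $d-1$ with coefficients in the ring $\mathbb{Z}\left[\frac{1}{\# S}\right]$. In particular, it is an algebraic integer. 3. $\mathrm{FPP}(W_S) = 0$ if and only if $f_S'(0) \leq 1$ and $f_S$ is not the identity function. 4. $\mathrm{FPP}(W_S) = 1$ if and only if every element in $S$ fixes at least one element in $\{1,\dots,d\}$.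
   Context: $T$ is the $d$-regular rooted tree, identified with the set of finite words over $\{1,\dots,d\}$; $\mathcal{L}_n$ is its $n$-th level and $\mathrm{Aut}(T)$ is the group of bijections of $T$ fixing the root and preserving adjacency. $\mathrm{Sym}(d)$ is the group of permutations of $\{1,\dots,d\}$. $\pi_n$ denotes the restriction of the action of an element of $\mathrm{Aut}(T)$ to the first $n$ levels of $T$. For $g \in \mathrm{Aut}(T)$ and $v \in T$, the section $g|_v \in \mathrm{Aut}(T)$ is defined by $g(vw)=g(v)\,g|_v(w)$ for all words $w$, and the label $g|_v^1 \in \mathrm{Sym}(d)$ is the permutation of $\{1,\dots,d\}$ induced by $g|_v$ on the first level. For $S \subseteq \mathrm{Sym}(d)$, the iterated wreath product is the set $W_S := \{g \in \mathrm{Aut}(T) : g|_v^1 \in S \text{ for all } v \in T\}$ (not necessarily a subgroup). For a subset $X \subseteq \mathrm{Aut}(T)$, $$\mathrm{FPP}(X) := \lim_{n\to\infty} \frac{\#\{x \in \pi_n(X) : x \text{ fixes a vertex in } \mathcal{L}_n\}}{\#\pi_n(X)}$$ when the limit exists; for $X = W_S$ the limit always exists.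
   Formalization: S is assumed nonempty. "Algebraic integer" in item 2 is false in general (d=4, S={(1 2),(1 3),(1 2 3 4)} gives FPP = 1/2); it is replaced by: FPP(W_S) is algebraic, and is an algebraic integer when S contains the identity. *)

theory Defs
  imports
    "HOL-Library.FuncSet"
    "HOL-Combinatorics.Permutations"
    "HOL-Computational_Algebra.Polynomial"
begin

definition tree :: "nat \<Rightarrow> nat list set" where
  "tree d = lists {1..d}"

definition level :: "nat \<Rightarrow> nat \<Rightarrow> nat list set" where
  "level d n = {w \<in> tree d. length w = n}"

definition adjacent :: "nat list \<Rightarrow> nat list \<Rightarrow> bool" where
  "adjacent v w \<longleftrightarrow> (\<exists>i. w = v @ [i] \<or> v = w @ [i])"

text \<open>Bijections of the tree are total functions that are the identity on all other lists.\<close>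

definition Aut :: "nat \<Rightarrow> (nat list \<Rightarrow> nat list) set" where
  "Aut d = {g. g permutes tree d \<and> g [] = [] \<and>
     (\<forall>v\<in>tree d. \<forall>w\<in>tree d. adjacent (g v) (g w) \<longleftrightarrow> adjacent v w)}"

definition restr :: "nat \<Rightarrow> nat \<Rightarrow> (nat list \<Rightarrow> nat list) \<Rightarrow> nat list \<Rightarrow> nat list" where
  "restr d n g = restrict g (\<Union>k\<le>n. level d k)"

text \<open>The section of \<open>g\<close> at \<open>v\<close> removes the prefix \<open>g v\<close> from \<open>g (v @ w)\<close>; see
  \<open>section_append\<close> below.\<close>

definition section_at :: "nat \<Rightarrow> (nat list \<Rightarrow> nat list) \<Rightarrow> nat list \<Rightarrow> nat list \<Rightarrow> nat list" where
  "section_at d g v w = (if w \<in> tree d then drop (length (g v)) (g (v @ w)) else w)"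

definition label :: "nat \<Rightarrow> (nat list \<Rightarrow> nat list) \<Rightarrow> nat list \<Rightarrow> nat \<Rightarrow> nat" where
  "label d g v i = (if i \<in> {1..d} then hd (section_at d g v [i]) else i)"

definition wreath :: "nat \<Rightarrow> (nat \<Rightarrow> nat) set \<Rightarrow> (nat list \<Rightarrow> nat list) set" where
  "wreath d S = {g \<in> Aut d. \<forall>v\<in>tree d. label d g v \<in> S}"

definition fixing_ratio :: "nat \<Rightarrow> (nat list \<Rightarrow> nat list) set \<Rightarrow> nat \<Rightarrow> real" where
  "fixing_ratio d X n =
     real (card {x \<in> restr d n ` X. \<exists>v\<in>level d n. x v = v}) / real (card (restr d n ` X))"

text \<open>\<open>lim\<close> is only meaningful when the sequence is \<open>convergent\<close>.\<close>

definition FPP :: "nat \<Rightarrow> (nat list \<Rightarrow> nat list) set \<Rightarrow> real" where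
  "FPP d X = lim (fixing_ratio d X)"

definition num_fix :: "nat \<Rightarrow> (nat \<Rightarrow> nat) set \<Rightarrow> nat \<Rightarrow> nat" where
  "num_fix d S k = card {s \<in> S. card {i \<in> {1..d}. s i = i} = k}"

definition fix_poly :: "nat \<Rightarrow> (nat \<Rightarrow> nat) set \<Rightarrow> real poly" where
  "fix_poly d S =
     (\<Sum>k=1..d. smult (real (num_fix d S k) / real (card S)) (1 - (1 - [:0, 1:]) ^ k))"

text \<open>The subring \<open>\<int>[a]\<close> of the reals.\<close>

definition int_adjoin :: "real \<Rightarrow> real set" where
  "int_adjoin a = {poly p a | p. \<forall>i. coeff p i \<in> \<int>}"

lemma Aut_length_append:
  assumes g: "g \<in> Aut d" and "w \<in> tree d"
  shows "length (g w) = length w \<and> (w \<noteq> [] \<longrightarrow> (\<exists>i. g w = g (butlast w) @ [i]))"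
  using assms(2)
proof (induction w rule: rev_induct)
  case Nil
  then show ?case using g by (simp add: Aut_def)
next
  case (snoc x u)
  have u: "u \<in> tree d" using snoc.prems by (simp add: tree_def)
  then have IH: "length (g u) = length u" "u \<noteq> [] \<Longrightarrow> \<exists>i. g u = g (butlast u) @ [i]"
    using snoc.IH by auto
  have "adjacent u (u @ [x])" by (simp add: adjacent_def)
  then have "adjacent (g u) (g (u @ [x]))" using g u snoc.prems by (simp add: Aut_def)
  then obtain i where i: "g (u @ [x]) = g u @ [i] \<or> g u = g (u @ [x]) @ [i]"
    by (auto simp: adjacent_def)
  have "g u \<noteq> g (u @ [x]) @ [i]"
  proof
    assume eq: "g u = g (u @ [x]) @ [i]"
    then have "u \<noteq> []" using g by (auto simp: Aut_def)
    then obtain j where "g u = g (butlast u) @ [j]" using IH(2) by blast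
    then have "g (butlast u) = g (u @ [x])" using eq by simp
    moreover have "inj g" using g by (auto simp: Aut_def permutes_inj)
    ultimately have "butlast u = u @ [x]" by (simp add: inj_eq)
    then have "length (butlast u) = length (u @ [x])" by simp
    then show False by simp
  qed
  then show ?case using i IH(1) by auto
qed

lemma section_append:
  assumes g: "g \<in> Aut d" and v: "v \<in> tree d" and "w \<in> tree d"
  shows "g (v @ w) = g v @ section_at d g v w"
proof -
  have "\<exists>u. g (v @ w) = g v @ u"
    using assms(3)
  proof (induction w rule: rev_induct)
    case (snoc x w)
    have "v @ w @ [x] \<in> tree d" using v snoc.prems by (simp add: tree_def)
    from Aut_length_append[OF g this]
    have "\<exists>i. g (v @ w @ [x]) = g (v @ w) @ [i]" by (simp add: butlast_append)
    moreover have "\<exists>u. g (v @ w) = g v @ u" using snoc by (simp add: tree_def)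
    ultimately show ?case by auto
  qed simp
  then show ?thesis using assms(3) by (auto simp: section_at_def)
qed

end

theory Submission
  imports Defs
begin

text \<open>
  An element of \<open>W\<^sub>S\<close> is the same as a root label in \<open>S\<close> together with \<open>d\<close> arbitrary elements of
  \<open>W\<^sub>S\<close> as its first-level sections, and this decomposition is compatible with restriction to finite
  levels. The element fixes no vertex of level \<open>n + 1\<close> iff no section at a fixed point of the root
  label fixes a vertex of level \<open>n\<close>. Hence the proportions satisfy \<open>r\<^sub>0 = 1\<close> and
  \<open>r\<^sub>n\<^sub>+\<^sub>1 = f (r\<^sub>n)\<close>, where \<open>f x\<close> is the average over \<open>S\<close> of \<open>1 - (1 - x)^k\<close> with \<open>k\<close> the number of
  fixed points. Since \<open>f\<close> is increasing on \<open>[0,1]\<close> with \<open>f 1 \<le> 1\<close>, the iterates decrease to the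
  largest fixed point. The polynomial \<open>#S * (f x - x) / x\<close> has integer coefficients, and the
  identity is the only permutation contributing to its coefficient of degree \<open>d - 1\<close>, which is thus
  \<open>1\<close> or \<open>-1\<close> if \<open>id \<in> S\<close>. Bernoulli's inequality \<open>1 - (1 - x)^k \<le> k * x\<close>, strict for \<open>k \<ge> 2\<close>,
  decides when \<open>0\<close> is the only fixed point.
\<close>

subsection \<open>Decomposition at the root\<close>

text \<open>Inverse of the decomposition of an automorphism into root label and first-level
  sections. Only the values \<open>g i\<close> with \<open>i\<close> in \<open>{1..d}\<close>
  matter; non-words are fixed, as \<open>Aut\<close> demands.\<close>

definition node :: "nat \<Rightarrow> (nat \<Rightarrow> nat) \<Rightarrow> (nat \<Rightarrow> nat list \<Rightarrow> nat list) \<Rightarrow> nat list \<Rightarrow> nat list" where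
  "node d s g w = (if w \<in> tree d then (case w of [] \<Rightarrow> [] | i # u \<Rightarrow> s i # g i u) else w)"

lemma Nil_in_tree [simp]: "[] \<in> tree d"
  by (simp add: tree_def)

lemma Cons_in_tree [simp]: "i # w \<in> tree d \<longleftrightarrow> i \<in> {1..d} \<and> w \<in> tree d"
  by (simp add: tree_def)

lemma append_in_tree [simp]: "v @ w \<in> tree d \<longleftrightarrow> v \<in> tree d \<and> w \<in> tree d"
  by (auto simp: tree_def)

lemma adjacent_append [simp]: "adjacent (p @ v) (p @ w) \<longleftrightarrow> adjacent v w"
  by (simp add: adjacent_def)

lemma not_adjacent_Nil_Nil [simp]: "\<not> adjacent [] []"
  by (simp add: adjacent_def)

lemma adjacent_Nil_Cons [simp]:
  "adjacent [] (i # w) \<longleftrightarrow> w = []" "adjacent (i # w) [] \<longleftrightarrow> w = []"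
  by (auto simp: adjacent_def)

lemma adjacent_Cons_Cons [simp]:
  "adjacent (i # v) (j # w) \<longleftrightarrow> i = j \<and> adjacent v w"
  by (auto simp: adjacent_def)

lemma Aut_in_tree:
  assumes "g \<in> Aut d"
  shows "g w \<in> tree d \<longleftrightarrow> w \<in> tree d"
  using assms by (auto simp: Aut_def permutes_in_image)

lemma Aut_length:
  assumes "g \<in> Aut d" "w \<in> tree d"
  shows "length (g w) = length w"
  using Aut_length_append[OF assms] by simp

lemma Aut_inj:
  assumes "g \<in> Aut d"
  shows "g v = g w \<longleftrightarrow> v = w"
  using assms by (auto simp: Aut_def dest: permutes_inj injD)

lemma permutesI:
  assumes "\<And>w. w \<notin> A \<Longrightarrow> f w = w"
    and "\<And>w. w \<in> A \<Longrightarrow> f w \<in> A"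
    and "\<And>v w. v \<in> A \<Longrightarrow> w \<in> A \<Longrightarrow> f v = f w \<Longrightarrow> v = w"
    and "\<And>u. u \<in> A \<Longrightarrow> \<exists>w\<in>A. f w = u"
  shows "f permutes A"
proof (rule bij_imp_permutes)
  show "bij_betw f A A"
    unfolding bij_betw_def inj_on_def using assms(2-4) by (auto simp: image_iff) metis
qed (use assms(1) in auto)

text \<open>Injectivity and adjacency are inherited from \<open>g\<close> by cancelling the common
  prefix \<open>g v\<close>. Surjectivity needs an argument: a preimage of \<open>g v @ u\<close>
  must itself start with \<open>v\<close>.\<close>

lemma section_at_in_Aut:
  assumes g: "g \<in> Aut d" and v: "v \<in> tree d"
  shows "section_at d g v \<in> Aut d"
proof -
  let ?h = "section_at d g v"
  have app: "g (v @ w) = g v @ ?h w" if "w \<in> tree d" for w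
    using section_append[OF g v that] .
  have gv: "g v \<in> tree d" using g v by (simp add: Aut_in_tree)
  have "?h permutes tree d"
  proof (rule permutesI)
    fix w assume w: "w \<in> tree d"
    have "g (v @ w) \<in> tree d" using g v w by (simp add: Aut_in_tree)
    then show "?h w \<in> tree d" using app[OF w] by simp
  next
    fix w w' assume "w \<in> tree d" "w' \<in> tree d" "?h w = ?h w'"
    then have "g (v @ w) = g (v @ w')" by (simp add: app)
    then show "w = w'" using g by (simp add: Aut_inj)
  next
    fix u assume u: "u \<in> tree d"
    have "g permutes tree d" using g by (simp add: Aut_def)
    moreover have "g v @ u \<in> tree d" using gv u by simp
    ultimately obtain z where z: "z \<in> tree d" "g z = g v @ u"
      by (metis permutes_image image_iff)
    \<comment> \<open>Automorphisms preserve length and prefixes, so the initial segment of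
      \<open>z\<close> of length \<open>length v\<close> is mapped to \<open>g v\<close>; by
      injectivity it is \<open>v\<close>.\<close>
    define p where "p = take (length v) z"
    define q where "q = drop (length v) z"
    have zpq: "z = p @ q" by (simp add: p_def q_def)
    have pq: "p \<in> tree d" "q \<in> tree d" using z(1) zpq by auto
    have "length z = length v + length u"
      using Aut_length[OF g z(1)] Aut_length[OF g v] z(2) by simp
    then have "length p = length v" by (simp add: p_def)
    then have "length (g p) = length (g v)" using g v pq by (simp add: Aut_length)
    moreover have "g p @ section_at d g p q = g v @ u"
      using section_append[OF g pq] z(2) zpq by simp
    ultimately have "g p = g v" by simp
    then have "p = v" using g by (simp add: Aut_inj)
    then have "?h q = u" using app[OF pq(2)] z(2) zpq by simp
    then show "\<exists>w\<in>tree d. ?h w = u" using pq by blast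
  qed (simp add: section_at_def)
  moreover have "?h [] = []" using app[of "[]"] by simp
  moreover have "adjacent (?h u) (?h w) \<longleftrightarrow> adjacent u w" if "u \<in> tree d" "w \<in> tree d" for u w
  proof -
    have "adjacent (?h u) (?h w) \<longleftrightarrow> adjacent (g (v @ u)) (g (v @ w))"
      using that by (simp add: app)
    also have "\<dots> \<longleftrightarrow> adjacent (v @ u) (v @ w)"
      using g v that by (simp add: Aut_def del: adjacent_append)
    finally show ?thesis by simp
  qed
  ultimately show ?thesis by (simp add: Aut_def)
qed

text \<open>Both sides are what remains of \<open>g (v @ u @ w)\<close> once the image of the prefix
  \<open>v @ u\<close> is removed. Consequently, sections of elements of \<open>wreath d S\<close>
  stay in it.\<close>

lemma section_at_section_at:
  assumes g: "g \<in> Aut d" and v: "v \<in> tree d" and u: "u \<in> tree d"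
  shows "section_at d (section_at d g v) u = section_at d g (v @ u)"
proof
  fix w
  show "section_at d (section_at d g v) u w = section_at d g (v @ u) w"
  proof (cases "w \<in> tree d")
    case True
    have "g v @ section_at d g v u @ section_at d (section_at d g v) u w = g (v @ (u @ w))"
      using section_append[OF g v, of "u @ w"] section_append[OF section_at_in_Aut[OF g v] u True]
        u True by simp
    also have "\<dots> = (g v @ section_at d g v u) @ section_at d g (v @ u) w"
      using section_append[OF g, of "v @ u" w] section_append[OF g v u] u v True by simp
    finally show ?thesis by simp
  qed (simp add: section_at_def)
qed

lemma label_section_at:
  assumes "g \<in> Aut d" "v \<in> tree d" "u \<in> tree d"
  shows "label d (section_at d g v) u = label d g (v @ u)"
  by (rule ext) (simp add: label_def section_at_section_at[OF assms])

lemma section_at_in_wreath: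
  assumes "g \<in> wreath d S" "v \<in> tree d"
  shows "section_at d g v \<in> wreath d S"
  using assms by (simp add: wreath_def section_at_in_Aut label_section_at)

text \<open>Length is preserved, so \<open>g [i]\<close> is a single letter: the value of the root
  label at \<open>i\<close>. The section at \<open>[i]\<close> supplies the remaining
  letters.\<close>

lemma node_label_section:
  assumes g: "g \<in> Aut d"
  shows "g = node d (label d g []) (\<lambda>i. section_at d g [i])"
proof
  fix w
  show "g w = node d (label d g []) (\<lambda>i. section_at d g [i]) w"
  proof (cases "w \<in> tree d")
    case False
    then show ?thesis using g by (auto simp: node_def Aut_def permutes_not_in)
  next
    case True
    have nil: "g [] = []" using g by (simp add: Aut_def)
    show ?thesis
    proof (cases w)
      case Nil
      then show ?thesis using nil by (simp add: node_def)
    next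
      case (Cons i u)
      then have i: "i \<in> {1..d}" "[i] \<in> tree d" and u: "u \<in> tree d" using True by auto
      have "length (g [i]) = 1" using Aut_length[OF g i(2)] by simp
      then obtain j where j: "g [i] = [j]" by (auto simp: length_Suc_conv)
      have "label d g [] i = j" using i nil j by (simp add: label_def section_at_def)
      moreover have "g ([i] @ u) = [j] @ section_at d g [i] u"
        using section_append[OF g i(2) u] j by simp
      ultimately show ?thesis using Cons True by (simp add: node_def)
    qed
  qed
qed

lemma node_in_Aut:
  assumes s: "s permutes {1..d}" and g: "\<And>i. i \<in> {1..d} \<Longrightarrow> g i \<in> Aut d"
  shows "node d s g \<in> Aut d"
proof -
  have sin: "s i \<in> {1..d} \<longleftrightarrow> i \<in> {1..d}" for i using s by (rule permutes_in_image)
  have sinj: "s i = s j \<longleftrightarrow> i = j" for i j using permutes_inj[OF s] by (auto dest: injD)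
  \<comment> \<open>Adjacency of the root to \<open>i # w\<close> depends only on whether
    \<open>w\<close> is empty, so the components must preserve emptiness.\<close>
  have g_nil: "g i w = [] \<longleftrightarrow> w = []" if "i \<in> {1..d}" "w \<in> tree d" for i w
    using Aut_length[OF g[OF that(1)] that(2)] by (metis length_0_conv)
  have "node d s g permutes tree d"
  proof (rule permutesI)
    fix w assume "w \<in> tree d"
    then show "node d s g w \<in> tree d"
      using sin by (cases w) (simp_all add: node_def Aut_in_tree[OF g] del: atLeastAtMost_iff)
  next
    fix v w assume "v \<in> tree d" "w \<in> tree d" "node d s g v = node d s g w"
    then show "v = w"
      by (cases v; cases w) (auto simp: node_def sinj Aut_inj[OF g] simp del: atLeastAtMost_iff)
  next
    fix u assume u: "u \<in> tree d"
    show "\<exists>w\<in>tree d. node d s g w = u"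
    proof (cases u)
      case Nil
      then show ?thesis by (intro bexI[of _ "[]"]) (auto simp: node_def)
    next
      case (Cons j t)
      then have j: "j \<in> {1..d}" and t: "t \<in> tree d" using u by (auto simp del: atLeastAtMost_iff)
      obtain i where i: "i \<in> {1..d}" "s i = j" using permutes_image[OF s] j by (metis image_iff)
      have "g i permutes tree d" using g[OF i(1)] by (simp add: Aut_def)
      then obtain w where w: "w \<in> tree d" "g i w = t" using t by (metis permutes_image image_iff)
      show ?thesis using i w Cons by (intro bexI[of _ "i # w"]) (auto simp: node_def)
    qed
  qed (simp add: node_def)
  moreover have "adjacent (node d s g v) (node d s g w) \<longleftrightarrow> adjacent v w"
    if "v \<in> tree d" "w \<in> tree d" for v w
  proof -
    have "adjacent (g i u) (g i t) \<longleftrightarrow> adjacent u t"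
      if "i \<in> {1..d}" "u \<in> tree d" "t \<in> tree d" for i u t
      using g[OF that(1)] that by (simp add: Aut_def)
    then show ?thesis using that
      by (cases v; cases w) (auto simp: node_def sinj g_nil simp del: atLeastAtMost_iff)
  qed
  ultimately show ?thesis by (simp add: Aut_def node_def)
qed

lemma label_node_Nil:
  assumes "s permutes {1..d}"
  shows "label d (node d s g) [] = s"
  using permutes_not_in[OF assms]
  by (auto simp: label_def section_at_def node_def fun_eq_iff)

lemma label_node_Cons:
  assumes "i \<in> {1..d}" "v \<in> tree d"
  shows "label d (node d s g) (i # v) = label d (g i) v"
  using assms by (auto simp: label_def section_at_def node_def fun_eq_iff)

lemma node_in_wreath:
  assumes S: "S \<subseteq> {s. s permutes {1..d}}" and s: "s \<in> S"
    and g: "\<And>i. i \<in> {1..d} \<Longrightarrow> g i \<in> wreath d S"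
  shows "node d s g \<in> wreath d S"
proof -
  have p: "s permutes {1..d}" using S s by auto
  have "node d s g \<in> Aut d" using g by (intro node_in_Aut p) (simp add: wreath_def)
  moreover have "label d (node d s g) v \<in> S" if "v \<in> tree d" for v
    using that g s by (cases v) (auto simp: label_node_Nil[OF p] label_node_Cons wreath_def)
  ultimately show ?thesis by (simp add: wreath_def)
qed

text \<open>This keeps the denominators of the fixing ratios nonzero.\<close>

lemma wreath_nonempty:
  assumes S: "S \<subseteq> {s. s permutes {1..d}}" and "S \<noteq> {}"
  shows "wreath d S \<noteq> {}"
proof -
  obtain s where s: "s \<in> S" using assms by auto
  have p: "s permutes {1..d}" using S s by auto
  have sin: "s i \<in> {1..d} \<longleftrightarrow> i \<in> {1..d}" for i using p by (rule permutes_in_image)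
  have sinj: "inj s" using permutes_inj[OF p] .
  \<comment> \<open>Acting by \<open>s\<close> on every letter gives an automorphism whose label is
    \<open>s\<close> at every vertex.\<close>
  define g where "g w = (if w \<in> tree d then map s w else w)" for w
  have map_tree: "map s w \<in> tree d \<longleftrightarrow> w \<in> tree d" for w
    using sin by (induction w) auto
  have "g permutes tree d"
  proof (rule permutesI)
    fix v w assume "v \<in> tree d" "w \<in> tree d" "g v = g w"
    then show "v = w" using sinj by (simp add: g_def)
  next
    fix u assume u: "u \<in> tree d"
    have "map s (map (inv s) u) = u" using p by (simp add: permutes_surj o_def surj_f_inv_f)
    then show "\<exists>w\<in>tree d. g w = u" using u map_tree by (metis g_def)
  qed (auto simp: g_def map_tree)
  moreover have "adjacent (g v) (g w) \<longleftrightarrow> adjacent v w" if "v \<in> tree d" "w \<in> tree d" for v w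
  proof -
    have "adjacent (map s v) (map s w) \<longleftrightarrow> adjacent v w"
    proof (induction v arbitrary: w)
      case Nil
      then show ?case by (cases w) auto
    next
      case (Cons a v)
      then show ?case using sinj by (cases w) (auto dest: injD)
    qed
    then show ?thesis using that by (simp add: g_def)
  qed
  ultimately have "g \<in> Aut d" by (simp add: Aut_def g_def)
  moreover have "label d g v = s" if "v \<in> tree d" for v
    using that permutes_not_in[OF p]
    by (auto simp: label_def section_at_def g_def fun_eq_iff)
  ultimately have "g \<in> wreath d S" using s by (simp add: wreath_def)
  then show ?thesis by auto
qed

section \<open>Restrictions to finite levels\<close>

text \<open>Finite-level counterpart of \<open>node\<close>: a label and truncated sections of depth
  \<open>n\<close> yield a truncated map of depth \<open>Suc n\<close>. Restricting makes the values
  extensional, so that distinct maps can be counted.\<close>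

definition glue ::
  "nat \<Rightarrow> nat \<Rightarrow> (nat \<Rightarrow> nat) \<times> (nat \<Rightarrow> nat list \<Rightarrow> nat list) \<Rightarrow> nat list \<Rightarrow> nat list" where
  "glue d n = (\<lambda>(s, y).
     restrict (\<lambda>w. case w of [] \<Rightarrow> [] | i # u \<Rightarrow> s i # y i u) {w \<in> tree d. length w \<le> Suc n})"

lemma restr_eq: "restr d n g = restrict g {w \<in> tree d. length w \<le> n}"
proof -
  have "(\<Union>k\<le>n. level d k) = {w \<in> tree d. length w \<le> n}" by (auto simp: level_def)
  then show ?thesis by (simp add: restr_def)
qed

lemma restr_node:
  "restr d (Suc n) (node d s g) = glue d n (s, \<lambda>i\<in>{1..d}. restr d n (g i))"
  by (auto simp: restr_eq glue_def node_def restrict_def fun_eq_iff split: list.split)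

text \<open>Membership in \<open>wreath d S\<close> is a condition at each vertex separately, so the
  label and the truncated sections can be chosen independently; any choice lifts to the full tree
  through \<open>node\<close>.\<close>

lemma restr_wreath_Suc:
  assumes S: "S \<subseteq> {s. s permutes {1..d}}"
  shows "restr d (Suc n) ` wreath d S = glue d n ` (S \<times> ({1..d} \<rightarrow>\<^sub>E restr d n ` wreath d S))"
    (is "?L = ?R")
proof
  show "?L \<subseteq> ?R"
  proof
    fix x assume "x \<in> ?L"
    then obtain g where g: "g \<in> wreath d S" and x: "x = restr d (Suc n) g" by blast
    have "label d g [] \<in> S" using g by (simp add: wreath_def)
    moreover have "section_at d g [i] \<in> wreath d S" if "i \<in> {1..d}" for i
      using section_at_in_wreath[OF g] that by simp
    moreover have "x = glue d n (label d g [], \<lambda>i\<in>{1..d}. restr d n (section_at d g [i]))"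
    proof -
      have "g \<in> Aut d" using g by (simp add: wreath_def)
      from arg_cong[OF node_label_section[OF this], of "restr d (Suc n)"]
      show ?thesis unfolding x by (simp only: restr_node)
    qed
    ultimately show "x \<in> ?R" by (auto intro!: image_eqI)
  qed
next
  show "?R \<subseteq> ?L"
  proof
    fix x assume "x \<in> ?R"
    then obtain s y where s: "s \<in> S" and y: "y \<in> {1..d} \<rightarrow>\<^sub>E restr d n ` wreath d S"
      and x: "x = glue d n (s, y)" by auto
    have "\<forall>i\<in>{1..d}. \<exists>g\<in>wreath d S. y i = restr d n g" using y by (auto simp: PiE_def Pi_def)
    then obtain g where g: "\<And>i. i \<in> {1..d} \<Longrightarrow> g i \<in> wreath d S"
        "\<And>i. i \<in> {1..d} \<Longrightarrow> y i = restr d n (g i)" by metis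
    have "y = (\<lambda>i\<in>{1..d}. restr d n (g i))"
      using y g(2) by (intro ext) (auto simp: restrict_def PiE_def extensional_def)
    then have "x = restr d (Suc n) (node d s g)" using x restr_node by simp
    moreover have "node d s g \<in> wreath d S" using node_in_wreath[OF S s] g(1) by blast
    ultimately show "x \<in> ?L" by blast
  qed
qed

text \<open>Words of length one reveal the label and longer words the sections. Elsewhere nothing is
  free: permutations fix what lies outside \<open>{1..d}\<close>, and restrictions are
  \<open>undefined\<close> off their domain.\<close>

lemma inj_on_glue:
  assumes S: "S \<subseteq> {s. s permutes {1..d}}"
  shows "inj_on (glue d n) (S \<times> ({1..d} \<rightarrow>\<^sub>E restr d n ` X))"
proof (rule inj_onI, clarify)
  fix s y s' y'
  assume s: "s \<in> S" "s' \<in> S" and y: "y \<in> {1..d} \<rightarrow>\<^sub>E restr d n ` X" "y' \<in> {1..d} \<rightarrow>\<^sub>E restr d n ` X"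
    and eq: "glue d n (s, y) = glue d n (s', y')"
  have Cons: "s i = s' i \<and> y i u = y' i u" if "i \<in> {1..d}" "u \<in> tree d" "length u \<le> n" for i u
    using fun_cong[OF eq, of "i # u"] that by (simp add: glue_def)
  have s_eq: "s i = s' i" for i
  proof (cases "i \<in> {1..d}")
    case True
    then show ?thesis using Cons[of i "[]"] by simp
  next
    case False
    have "s permutes {1..d}" "s' permutes {1..d}" using s S by auto
    then show ?thesis using False by (metis permutes_not_in)
  qed
  have "y i = y' i" if i: "i \<in> {1..d}" for i
  proof
    fix u
    have "y i \<in> restr d n ` X" "y' i \<in> restr d n ` X" using y i by auto
    then show "y i u = y' i u"
      using Cons[OF i, of u] by (cases "u \<in> tree d \<and> length u \<le> n") (auto simp: restr_eq)
  qed
  then have "y = y'" using y by (rule PiE_ext[rotated 2])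
  with s_eq show "s = s' \<and> y = y'" by blast
qed

lemma finite_permutes_subset:
  assumes "S \<subseteq> {s. s permutes {1..d :: nat}}"
  shows "finite S"
  using assms finite_permutations[of "{1..d}"] by (auto intro: finite_subset)

lemma finite_restr_wreath:
  assumes S: "S \<subseteq> {s. s permutes {1..d}}"
  shows "finite (restr d n ` wreath d S)"
proof (induction n)
  case 0
  have "restr d 0 g = restrict (\<lambda>_. []) {[]}" if "g \<in> wreath d S" for g
    using that by (auto simp: restr_eq wreath_def Aut_def fun_eq_iff)
  then have "restr d 0 ` wreath d S \<subseteq> {restrict (\<lambda>_. []) {[]}}" by auto
  then show ?case by (rule finite_subset) simp
next
  case (Suc n)
  then have "finite ({1..d} \<rightarrow>\<^sub>E restr d n ` wreath d S)" by (rule finite_PiE[OF finite_atLeastAtMost])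
  then show ?case
    unfolding restr_wreath_Suc[OF S]
    by (intro finite_imageI finite_cartesian_product finite_permutes_subset[OF S])
qed

subsection \<open>The recursion for the fixing ratio\<close>

definition fixed_points :: "nat \<Rightarrow> (nat \<Rightarrow> nat) \<Rightarrow> nat" where
  "fixed_points d s = card {i \<in> {1..d}. s i = i}"

lemma card_restr_wreath_Suc:
  assumes S: "S \<subseteq> {s. s permutes {1..d}}"
  shows "card (restr d (Suc n) ` wreath d S) = card S * card (restr d n ` wreath d S) ^ d"
  by (simp add: restr_wreath_Suc[OF S] card_image[OF inj_on_glue[OF S]] card_cartesian_product card_PiE
      del: One_nat_def)

definition fixes_level :: "nat \<Rightarrow> nat \<Rightarrow> (nat list \<Rightarrow> nat list) \<Rightarrow> bool" where
  "fixes_level d n x \<longleftrightarrow> (\<exists>v\<in>level d n. x v = v)"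

lemma fixes_level_glue:
  "fixes_level d (Suc n) (glue d n (s, y)) \<longleftrightarrow> (\<exists>i\<in>{1..d}. s i = i \<and> fixes_level d n (y i))"
proof
  assume "fixes_level d (Suc n) (glue d n (s, y))"
  then obtain v where v: "v \<in> level d (Suc n)" "glue d n (s, y) v = v" by (auto simp: fixes_level_def)
  then obtain i u where iu: "v = i # u" by (cases v) (auto simp: level_def)
  then have "i \<in> {1..d}" "u \<in> level d n" "s i = i" "y i u = u"
    using v by (auto simp: level_def glue_def)
  then show "\<exists>i\<in>{1..d}. s i = i \<and> fixes_level d n (y i)" by (auto simp: fixes_level_def)
next
  assume "\<exists>i\<in>{1..d}. s i = i \<and> fixes_level d n (y i)"
  then obtain i u where "i \<in> {1..d}" "u \<in> level d n" "s i = i" "y i u = u"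
    by (auto simp: fixes_level_def)
  then show "fixes_level d (Suc n) (glue d n (s, y))"
    unfolding fixes_level_def by (intro bexI[of _ "i # u"]) (auto simp: level_def glue_def)
qed

text \<open>Fixing no vertex is a condition on each section separately: at a fixed point of the
  label the section must fix none, elsewhere it is arbitrary. For each label the count is therefore
  a product, which is why the complement of the fixing event is counted.\<close>

lemma card_nonfixing_Suc:
  assumes S: "S \<subseteq> {s. s permutes {1..d}}"
  defines "A \<equiv> \<lambda>n. restr d n ` wreath d S"
  shows "card {x \<in> A (Suc n). \<not> fixes_level d (Suc n) x} =
    (\<Sum>s\<in>S. card {x \<in> A n. \<not> fixes_level d n x} ^ fixed_points d s *
      card (A n) ^ (d - fixed_points d s))"
proof -
  let ?N = "{x \<in> A n. \<not> fixes_level d n x}"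
  let ?P = "\<lambda>s. PiE {1..d} (\<lambda>i. if s i = i then ?N else A n)"
  have fin: "finite (A n)" unfolding A_def by (rule finite_restr_wreath[OF S])
  have sub: "Sigma S ?P \<subseteq> S \<times> ({1..d} \<rightarrow>\<^sub>E A n)"
    by (auto simp: PiE_iff split: if_splits)
  have inj: "inj_on (glue d n) (S \<times> ({1..d} \<rightarrow>\<^sub>E A n))"
    unfolding A_def by (rule inj_on_glue[OF S])
  have "{x \<in> A (Suc n). \<not> fixes_level d (Suc n) x} =
      glue d n ` {p \<in> S \<times> ({1..d} \<rightarrow>\<^sub>E A n). \<not> fixes_level d (Suc n) (glue d n p)}"
    unfolding A_def restr_wreath_Suc[OF S] by auto
  also have "{p \<in> S \<times> ({1..d} \<rightarrow>\<^sub>E A n). \<not> fixes_level d (Suc n) (glue d n p)} = Sigma S ?P"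
    by (auto simp: fixes_level_glue PiE_iff split: if_splits)
  finally have "card {x \<in> A (Suc n). \<not> fixes_level d (Suc n) x} = card (glue d n ` Sigma S ?P)"
    by simp
  also have "\<dots> = card (Sigma S ?P)"
    by (rule card_image[OF inj_on_subset[OF inj sub]])
  also have "\<dots> = (\<Sum>s\<in>S. card (?P s))"
    using fin by (intro card_SigmaI finite_permutes_subset[OF S] ballI finite_PiE) auto
  also have "\<dots> = (\<Sum>s\<in>S. card ?N ^ fixed_points d s * card (A n) ^ (d - fixed_points d s))"
  proof (rule sum.cong)
    fix s
    have "card (?P s) = (\<Prod>i\<in>{1..d}. if s i = i then card ?N else card (A n))"
      by (simp add: card_PiE if_distrib[of card])
    also have "\<dots> = card ?N ^ card ({1..d} \<inter> {i. s i = i}) * card (A n) ^ card ({1..d} \<inter> - {i. s i = i})"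
      by (simp add: prod.If_cases)
    also have "{1..d} \<inter> {i. s i = i} = {i \<in> {1..d}. s i = i}" by auto
    also have "{1..d} \<inter> - {i. s i = i} = {1..d} - {i \<in> {1..d}. s i = i}" by auto
    also have "card \<dots> = d - fixed_points d s"
      unfolding fixed_points_def by (subst card_Diff_subset) auto
    finally show "card (?P s) = card ?N ^ fixed_points d s * card (A n) ^ (d - fixed_points d s)"
      by (simp add: fixed_points_def)
  qed simp
  finally show ?thesis .
qed

lemma fixed_points_le: "fixed_points d s \<le> d"
proof -
  have "card {i \<in> {1..d}. s i = i} \<le> card {1..d}" by (rule card_mono) auto
  then show ?thesis by (simp add: fixed_points_def)
qed

text \<open>This is \<open>card S\<close> times \<open>fix_poly d S\<close>, summed over elements
  instead of numbers of fixed points; \<open>[:1, -1:]\<close> is \<open>1 - X\<close>. Clearing the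
  denominator makes the coefficients integers.\<close>

definition fix_sum :: "nat \<Rightarrow> (nat \<Rightarrow> nat) set \<Rightarrow> real poly" where
  "fix_sum d S = (\<Sum>s\<in>S. 1 - [:1, -1:] ^ fixed_points d s)"

lemma smult_sum_right: "smult c (\<Sum>i\<in>A. p i) = (\<Sum>i\<in>A. smult c (p i))"
  by (rule poly_eqI) (simp add: coeff_sum sum_distrib_left)

lemma fix_poly_eq:
  assumes "finite S"
  shows "fix_poly d S = smult (1 / real (card S)) (fix_sum d S)"
proof -
  let ?h = "\<lambda>k. 1 - [:1, -1:] ^ k :: real poly"
  have "fix_sum d S = (\<Sum>k=0..d. \<Sum>s\<in>{s \<in> S. fixed_points d s = k}. ?h (fixed_points d s))"
    unfolding fix_sum_def using assms fixed_points_le by (subst sum.group) auto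
  also have "\<dots> = (\<Sum>k=0..d. smult (real (num_fix d S k)) (?h k))"
    by (rule sum.cong) (auto simp: num_fix_def fixed_points_def of_nat_poly)
  \<comment> \<open>The term for \<open>k = 0\<close> is \<open>1 - 1\<close>.\<close>
  also have "\<dots> = (\<Sum>k=1..d. smult (real (num_fix d S k)) (?h k))"
    by (rule sum.mono_neutral_right) (auto simp: not_less_eq_eq)
  finally show ?thesis by (simp add: fix_poly_def smult_sum_right one_pCons)
qed

lemma fixing_ratio_0:
  assumes S: "S \<subseteq> {s. s permutes {1..d}}" and "S \<noteq> {}"
  shows "fixing_ratio d (wreath d S) 0 = 1"
proof -
  have "restr d 0 g [] = []" if "g \<in> wreath d S" for g
    using that by (simp add: restr_eq wreath_def Aut_def)
  then have "{x \<in> restr d 0 ` wreath d S. \<exists>v\<in>level d 0. x v = v} = restr d 0 ` wreath d S"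
    by (auto simp: level_def)
  moreover have "card (restr d 0 ` wreath d S) \<noteq> 0"
    using finite_restr_wreath[OF S] wreath_nonempty[OF assms] by simp
  ultimately show ?thesis by (simp add: fixing_ratio_def)
qed

text \<open>Dividing the count of non-fixing elements by the total count shows that the
  complementary ratio \<open>b n / a n\<close> is replaced by the average over \<open>S\<close> of
  its powers with exponent \<open>fixed_points d s\<close>.\<close>

lemma fixing_ratio_Suc:
  assumes S: "S \<subseteq> {s. s permutes {1..d}}" and ne: "S \<noteq> {}"
  shows "fixing_ratio d (wreath d S) (Suc n) = poly (fix_poly d S) (fixing_ratio d (wreath d S) n)"
proof -
  define a where "a n = real (card (restr d n ` wreath d S))" for n
  define b where "b n = real (card {x \<in> restr d n ` wreath d S. \<not> fixes_level d n x})" for n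
  have fin: "finite (restr d n ` wreath d S)" for n by (rule finite_restr_wreath[OF S])
  have a_pos: "a n > 0" for n
    using fin wreath_nonempty[OF assms] by (simp add: a_def card_gt_0_iff)
  have ratio: "fixing_ratio d (wreath d S) n = 1 - b n / a n" for n
  proof -
    let ?A = "restr d n ` wreath d S"
    have "card ({x \<in> ?A. fixes_level d n x} \<union> {x \<in> ?A. \<not> fixes_level d n x}) =
        card {x \<in> ?A. fixes_level d n x} + card {x \<in> ?A. \<not> fixes_level d n x}"
      using fin by (intro card_Un_disjoint) auto
    also have "{x \<in> ?A. fixes_level d n x} \<union> {x \<in> ?A. \<not> fixes_level d n x} = ?A" by auto
    finally have "real (card {x \<in> ?A. fixes_level d n x}) = a n - b n"
      by (simp add: a_def b_def)
    then show ?thesis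
      using a_pos[of n] by (simp add: fixing_ratio_def fixes_level_def flip: a_def) (simp add: diff_divide_distrib)
  qed
  have S_pos: "real (card S) > 0" using finite_permutes_subset[OF S] ne by (simp add: card_gt_0_iff)
  have "b (Suc n) / a (Suc n) = (\<Sum>s\<in>S. (b n / a n) ^ fixed_points d s) / card S"
  proof -
    have "b (Suc n) = (\<Sum>s\<in>S. b n ^ fixed_points d s * a n ^ (d - fixed_points d s))"
      by (simp add: b_def a_def card_nonfixing_Suc[OF S])
    \<comment> \<open>Every term is homogeneous of degree \<open>d\<close> in \<open>a n\<close> and
      \<open>b n\<close>; the extracted \<open>a n ^ d\<close> cancels against the one in
      \<open>a (Suc n)\<close>.\<close>
    also have "\<dots> = (\<Sum>s\<in>S. (b n / a n) ^ fixed_points d s * a n ^ d)"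
    proof (rule sum.cong)
      fix s
      have "a n ^ d = a n ^ fixed_points d s * a n ^ (d - fixed_points d s)"
        using fixed_points_le[of d s] by (simp flip: power_add)
      then show "b n ^ fixed_points d s * a n ^ (d - fixed_points d s) =
          (b n / a n) ^ fixed_points d s * a n ^ d"
        using a_pos[of n] by (simp add: power_divide)
    qed simp
    finally have "b (Suc n) = (\<Sum>s\<in>S. (b n / a n) ^ fixed_points d s) * a n ^ d"
      by (simp add: sum_distrib_right)
    moreover have "a (Suc n) = card S * a n ^ d"
      by (simp add: a_def card_restr_wreath_Suc[OF S])
    ultimately show ?thesis using a_pos[of n] by simp
  qed
  then show ?thesis
    using S_pos
    by (simp add: ratio fix_poly_eq[OF finite_permutes_subset[OF S]] fix_sum_def poly_sum
        sum_subtractf diff_divide_distrib)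
qed

subsection \<open>Fixed points of the polynomial\<close>

text \<open>By monotonicity every \<open>y\<close> with \<open>y \<le> f y\<close> stays below all
  iterates, hence below their limit. The bound is stated for such \<open>y\<close>, not only for
  fixed points, because a point above the diagonal is all that a derivative exceeding one
  provides.\<close>

lemma monotone_iteration_limit:
  fixes f :: "real \<Rightarrow> real" and r :: "nat \<Rightarrow> real"
  assumes mono: "\<And>x y. 0 \<le> x \<Longrightarrow> x \<le> y \<Longrightarrow> y \<le> 1 \<Longrightarrow> f x \<le> f y"
    and cont: "\<And>x. isCont f x" and f0: "0 \<le> f 0" and f1: "f 1 \<le> 1"
    and r0: "r 0 = 1" and rSuc: "\<And>n. r (Suc n) = f (r n)"
  obtains L where "r \<longlonglongrightarrow> L" "0 \<le> L" "L \<le> 1" "f L = L"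
    "\<And>y. 0 \<le> y \<Longrightarrow> y \<le> 1 \<Longrightarrow> y \<le> f y \<Longrightarrow> y \<le> L"
proof -
  have le: "y \<le> r n \<and> r n \<le> 1" if y: "0 \<le> y" "y \<le> 1" "y \<le> f y" for y n
  proof (induction n)
    case 0
    then show ?case using y r0 by simp
  next
    case (Suc n)
    then have "f y \<le> f (r n)" "f (r n) \<le> f 1" using y by (auto intro!: mono)
    then show ?case using y f1 rSuc by simp
  qed
  \<comment> \<open>The choice \<open>y = 0\<close> is admissible since
    \<open>0 \<le> f 0\<close>.\<close>
  have bounds: "0 \<le> r n" "r n \<le> 1" for n using le[of 0 n] f0 by auto
  have "r (Suc n) \<le> r n" for n
  proof (induction n)
    case 0
    then show ?case using bounds r0 by simp
  next
    case (Suc n)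
    then show ?case using mono[OF bounds(1) Suc bounds(2)] rSuc by simp
  qed
  then have "decseq r" by (rule decseq_SucI)
  then obtain L where L: "r \<longlonglongrightarrow> L" using bounds by (blast elim: decseq_convergent)
  have "(\<lambda>n. r (Suc n)) \<longlonglongrightarrow> f L"
    unfolding rSuc by (rule isCont_tendsto_compose[OF cont L])
  then have "f L = L" using LIMSEQ_Suc[OF L] LIMSEQ_unique by blast
  moreover have "y \<le> L" if "0 \<le> y" "y \<le> 1" "y \<le> f y" for y
    using le[OF that] by (intro LIMSEQ_le_const[OF L]) auto
  moreover have "0 \<le> L" "L \<le> 1"
    using bounds by (auto intro: LIMSEQ_le_const[OF L] LIMSEQ_le_const2[OF L])
  ultimately show thesis using L that by blast
qed

lemma Bernoulli_inequality_strict: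
  fixes x :: real
  assumes "0 < x" "x \<le> 1" "2 \<le> k"
  shows "1 - real k * x < (1 - x) ^ k"
proof -
  obtain j where j: "k = Suc j" "1 \<le> j" using assms(3) by (cases k) auto
  have "1 - real j * x \<le> (1 - x) ^ j" using Bernoulli_inequality[of "- x" j] assms by simp
  then have "(1 - x) * (1 - real j * x) \<le> (1 - x) * (1 - x) ^ j"
    using assms by (intro mult_left_mono) auto
  \<comment> \<open>This is the quadratic term of \<open>(1 - x) * (1 - real j * x)\<close>, the
    source of strictness.\<close>
  moreover have "0 < real j * x * x" using assms j by simp
  ultimately show ?thesis by (simp add: j algebra_simps)
qed

lemma poly_fix_poly:
  assumes "finite S"
  shows "poly (fix_poly d S) x = (\<Sum>s\<in>S. 1 - (1 - x) ^ fixed_points d s) / card S"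
  by (simp add: fix_poly_eq[OF assms] fix_sum_def poly_sum)

lemma poly_pderiv_fix_poly_0:
  assumes "finite S"
  shows "poly (pderiv (fix_poly d S)) 0 = (\<Sum>s\<in>S. real (fixed_points d s)) / card S"
  by (simp add: fix_poly_eq[OF assms] fix_sum_def poly_sum pderiv_smult higher_pderiv_sum[of 1, simplified] pderiv_diff
      pderiv_power pderiv_pCons)

lemma poly_fix_poly_mono:
  assumes "finite S" "x \<le> y" "y \<le> 1"
  shows "poly (fix_poly d S) x \<le> poly (fix_poly d S) y"
  unfolding poly_fix_poly[OF assms(1)]
  using assms by (intro divide_right_mono sum_mono diff_left_mono power_mono) auto

lemma poly_fix_poly_0:
  assumes "finite S"
  shows "poly (fix_poly d S) 0 = 0"
  by (simp add: poly_fix_poly[OF assms])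

text \<open>As \<open>0 ^ 0 = 1\<close>, the quotient is the proportion of elements of
  \<open>S\<close> without fixed points.\<close>

lemma poly_fix_poly_1:
  assumes "finite S" "S \<noteq> {}"
  shows "poly (fix_poly d S) 1 = 1 - (\<Sum>s\<in>S. 0 ^ fixed_points d s) / card S"
  using assms by (simp add: poly_fix_poly sum_subtractf diff_divide_distrib)

lemma poly_fix_poly_1_le:
  assumes "finite S" "S \<noteq> {}"
  shows "poly (fix_poly d S) 1 \<le> 1"
  using assms by (simp add: poly_fix_poly_1 sum_nonneg)

lemma poly_fix_poly_1_eq_1_iff:
  assumes "finite S" "S \<noteq> {}"
  shows "poly (fix_poly d S) 1 = 1 \<longleftrightarrow> (\<forall>s\<in>S. \<exists>i\<in>{1..d}. s i = i)"
proof -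
  have "poly (fix_poly d S) 1 = 1 \<longleftrightarrow> (\<Sum>s\<in>S. (0::real) ^ fixed_points d s) = 0"
    using assms by (simp add: poly_fix_poly_1)
  also have "\<dots> \<longleftrightarrow> (\<forall>s\<in>S. fixed_points d s \<noteq> 0)"
    using assms by (subst sum_nonneg_eq_0_iff) auto
  also have "\<dots> \<longleftrightarrow> (\<forall>s\<in>S. \<exists>i\<in>{1..d}. s i = i)"
    by (auto simp: fixed_points_def simp del: atLeastAtMost_iff)
  finally show ?thesis .
qed

text \<open>A positive fixed point forces equality in Bernoulli's inequality for every element of \<open>S\<close>.\<close>

lemma fix_poly_identity:
  assumes S: "finite S" "S \<noteq> {}" and x: "0 < x" "x \<le> 1"
    and fx: "poly (fix_poly d S) x = x" and m: "poly (pderiv (fix_poly d S)) 0 \<le> 1"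
  shows "poly (fix_poly d S) = (\<lambda>x. x)"
proof -
  let ?k = "fixed_points d"
  have c: "real (card S) > 0" using S by (simp add: card_gt_0_iff)
  have sum_x: "(\<Sum>s\<in>S. 1 - (1 - x) ^ ?k s) = x * card S"
    using fx c by (simp add: poly_fix_poly[OF S(1)] field_simps)
  have sum_k: "(\<Sum>s\<in>S. real (?k s)) \<le> card S"
    using m c by (simp add: poly_pderiv_fix_poly_0[OF S(1)])
  have nonneg: "0 \<le> real (?k s) * x - (1 - (1 - x) ^ ?k s)" for s
    using Bernoulli_inequality[of "- x" "?k s"] x by simp
  \<comment> \<open>The total deficit in Bernoulli's inequality is at most zero because the mean
    number of fixed points, which is the derivative at \<open>0\<close>, is at most one. Hence each
    nonnegative deficit vanishes.\<close>
  have "(\<Sum>s\<in>S. real (?k s) * x - (1 - (1 - x) ^ ?k s)) =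
      ((\<Sum>s\<in>S. real (?k s)) - card S) * x"
    by (simp only: sum_subtractf[of "\<lambda>s. real (?k s) * x"] sum_x flip: sum_distrib_right)
       (simp add: algebra_simps)
  also have "\<dots> \<le> 0" using sum_k x by (simp add: mult_le_0_iff)
  finally have "(\<Sum>s\<in>S. real (?k s) * x - (1 - (1 - x) ^ ?k s)) = 0"
    using nonneg by (intro antisym sum_nonneg) auto
  then have eq: "real (?k s) * x - (1 - (1 - x) ^ ?k s) = 0" if "s \<in> S" for s
    using nonneg S that by (subst (asm) sum_nonneg_eq_0_iff) auto
  have k: "?k s \<in> {0, 1}" if "s \<in> S" for s
    using eq[OF that] Bernoulli_inequality_strict[OF x, of "?k s"] by (cases "2 \<le> ?k s") auto
  \<comment> \<open>With at most one fixed point per element, \<open>1 - (1 - y) ^ k\<close> equals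
    \<open>k * y\<close>. The polynomial is then linear, and its positive fixed point forces slope
    one.\<close>
  define q where "q = (\<Sum>s\<in>S. real (?k s)) / card S"
  have lin: "poly (fix_poly d S) y = q * y" for y
  proof -
    have "(\<Sum>s\<in>S. 1 - (1 - y) ^ ?k s) = (\<Sum>s\<in>S. real (?k s) * y)"
      using k by (intro sum.cong) fastforce+
    then show ?thesis by (simp add: poly_fix_poly[OF S(1)] q_def sum_distrib_right)
  qed
  have "q = 1" using lin[of x] fx x by simp
  then show ?thesis using lin by (simp add: fun_eq_iff)
qed

text \<open>The difference between the polynomial and the identity vanishes at \<open>0\<close> with
  positive derivative, so it is positive just to the right of \<open>0\<close>.\<close>

lemma fix_poly_above_diagonal:
  assumes S: "finite S" and m: "1 < poly (pderiv (fix_poly d S)) 0"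
  obtains x where "0 < x" "x \<le> 1" "x \<le> poly (fix_poly d S) x"
proof -
  let ?g = "\<lambda>x. poly (fix_poly d S) x - x"
  have "(?g has_real_derivative poly (pderiv (fix_poly d S)) 0 - 1) (at 0)"
    by (auto intro!: derivative_eq_intros)
  from DERIV_pos_inc_right[OF this] m obtain e where e: "e > 0"
    "\<And>h. 0 < h \<Longrightarrow> h < e \<Longrightarrow> ?g 0 < ?g (0 + h)" by auto
  define h where "h = min (e / 2) 1"
  have "?g 0 < ?g (0 + h)" using e(1) by (intro e(2)) (auto simp: h_def)
  then show thesis using that[of h] e(1) by (auto simp: poly_fix_poly_0[OF S] h_def)
qed

section \<open>An integer polynomial vanishing at nonzero fixed points\<close>

lemma coeff_one_minus_X_power:
  "coeff ([:1, -1 :: real:] ^ k) i = (-1) ^ i * of_nat (k choose i)"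
proof (cases "i \<le> k")
  case True
  then show ?thesis by (simp add: coeff_linear_poly_power)
next
  case False
  have "degree ([:1, -1 :: real:] ^ k) \<le> k" using degree_power_le[of "[:1, -1 :: real:]" k] by simp
  then show ?thesis using False by (simp add: coeff_eq_0)
qed

lemma coeff_fix_sum:
  "coeff (fix_sum d S) i =
    (if i = 0 then 0 else - ((-1) ^ i * real (\<Sum>s\<in>S. fixed_points d s choose i)))"
  by (auto simp: fix_sum_def coeff_sum coeff_one_minus_X_power sum_negf simp flip: sum_distrib_left)

lemma fixed_points_eq_iff:
  assumes "s permutes {1..d}"
  shows "fixed_points d s = d \<longleftrightarrow> s = id"
proof
  assume "fixed_points d s = d"
  then have "{i \<in> {1..d}. s i = i} = {1..d}"
    by (intro card_subset_eq) (auto simp: fixed_points_def)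
  then have "s i = i" if "i \<in> {1..d}" for i using that by blast
  then have "s i = i" for i using permutes_not_in[OF assms] by blast
  then show "s = id" by (simp add: fun_eq_iff)
qed (simp add: fixed_points_def del: atLeastAtMost_iff)

text \<open>Multiplying the fixed-point equation by \<open>card S\<close> makes it integral, and
  dividing by \<open>X\<close> removes the root \<open>0\<close> and lowers the degree bound to
  \<open>d - 1\<close>.\<close>

lemma fix_poly_quotient:
  assumes d: "d \<ge> 2" and S: "S \<subseteq> {s. s permutes {1..d}}" "S \<noteq> {}"
  obtains P :: "real poly" where "degree P \<le> d - 1" "\<And>i. coeff P i \<in> \<int>"
    "\<And>x. x * poly P x = card S * (poly (fix_poly d S) x - x)"
    "id \<in> S \<Longrightarrow> coeff P (d - 1) = - ((-1) ^ d)"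
proof -
  have fin: "finite S" by (rule finite_permutes_subset[OF S(1)])
  define G where "G = fix_sum d S - [:0, real (card S):]"
  obtain P where P: "G = pCons 0 P"
  proof (cases G)
    case (pCons a p)
    have "coeff G 0 = 0" by (simp add: G_def coeff_fix_sum)
    then show thesis using pCons that by simp
  qed
  have coeff_P: "coeff P i = coeff G (Suc i)" for i by (simp add: P)
  \<comment> \<open>Subtracting \<open>card S * X\<close> affects only degree one, so from degree
    two on the coefficients are those of \<open>fix_sum d S\<close>.\<close>
  have coeff_G: "coeff G j = - ((-1) ^ j * real (\<Sum>s\<in>S. fixed_points d s choose j))" if "j \<ge> 2" for j
    using that by (auto simp: G_def coeff_fix_sum coeff_pCons split: nat.split)
  show thesis
  proof
    show "degree P \<le> d - 1"
    proof (rule degree_le, intro allI impI)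
      fix i assume "i > d - 1"
      then have "fixed_points d s < Suc i" for s using fixed_points_le[of d s] by linarith
      then have "(\<Sum>s\<in>S. fixed_points d s choose Suc i) = 0"
        by (intro sum.neutral ballI binomial_eq_0)
      then show "coeff P i = 0" using \<open>i > d - 1\<close> d by (subst coeff_P, subst coeff_G) simp_all
    qed
    show "coeff P i \<in> \<int>" for i
      by (auto simp: coeff_P G_def coeff_fix_sum coeff_pCons split: nat.split
          intro!: Ints_diff Ints_mult Ints_sum)
    show "x * poly P x = card S * (poly (fix_poly d S) x - x)" for x
    proof -
      have "x * poly P x = poly G x" by (simp add: P)
      also have "\<dots> = card S * (poly (fix_poly d S) x - x)"
        using fin S(2) by (simp add: G_def fix_poly_eq algebra_simps)
      finally show ?thesis .
    qed
    show "coeff P (d - 1) = - ((-1) ^ d)" if "id \<in> S"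
    proof -
      \<comment> \<open>A permutation with fewer than \<open>d\<close> fixed points contributes zero
        in degree \<open>d\<close>, and only \<open>id\<close> fixes all \<open>d\<close>
        points.\<close>
      have "fixed_points d s choose d = (if s = id then 1 else 0)" if "s \<in> S" for s
      proof -
        have "s permutes {1..d}" using S that by auto
        from fixed_points_eq_iff[OF this] show ?thesis using fixed_points_le[of d s]
          by (cases "fixed_points d s = d") (auto simp: binomial_eq_0)
      qed
      then have "(\<Sum>s\<in>S. fixed_points d s choose d) = (\<Sum>s\<in>S. if s = id then 1 else 0)"
        by (intro sum.cong) auto
      also have "\<dots> = 1" using that fin by simp
      finally have "coeff G d = - ((-1) ^ d)" using d by (simp add: coeff_G)
      then show ?thesis using d by (simp add: coeff_P)
    qed
  qed
qed

lemma Ints_subset_int_adjoin: "\<int> \<subseteq> int_adjoin a"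
proof
  fix c :: real assume c: "c \<in> \<int>"
  have "\<forall>i. coeff [:c:] i \<in> \<int>" using c by (auto simp: coeff_pCons split: nat.split)
  moreover have "c = poly [:c:] a" by simp
  ultimately show "c \<in> int_adjoin a" unfolding int_adjoin_def by blast
qed

text \<open>Integrality is claimed for \<open>id \<in> S\<close>, where the quotient polynomial is
  monic up to sign. Without \<open>id\<close> it can fail: for \<open>d = 4\<close> and
  \<open>S\<close> consisting of two transpositions and a 4-cycle, the fixed-point equation is
  \<open>2 * (2 * x - x^2) / 3 = x\<close>, whose largest solution is \<open>1/2\<close>.\<close>

theorem theorem3:
  fixes d :: nat and S :: "(nat \<Rightarrow> nat) set"
  assumes "d \<ge> 2"
    and "S \<subseteq> {s. s permutes {1..d}}"
    and "S \<noteq> {}"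
  shows "convergent (fixing_ratio d (wreath d S))
    \<and> (FPP d (wreath d S) \<in> {x \<in> {0..1}. poly (fix_poly d S) x = x}
       \<and> (\<forall>y \<in> {x \<in> {0..1}. poly (fix_poly d S) x = x}. y \<le> FPP d (wreath d S)))
    \<and> ((\<exists>p :: real poly. p \<noteq> 0 \<and> degree p \<le> d - 1
          \<and> (\<forall>i. coeff p i \<in> int_adjoin (1 / real (card S)))
          \<and> poly p (FPP d (wreath d S)) = 0)
       \<and> algebraic (FPP d (wreath d S))
       \<and> (id \<in> S \<longrightarrow> algebraic_int (FPP d (wreath d S))))
    \<and> (FPP d (wreath d S) = 0 \<longleftrightarrow>
         poly (pderiv (fix_poly d S)) 0 \<le> 1 \<and> poly (fix_poly d S) \<noteq> (\<lambda>x. x))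
    \<and> (FPP d (wreath d S) = 1 \<longleftrightarrow> (\<forall>s\<in>S. \<exists>i\<in>{1..d}. s i = i))"
proof -
  let ?f = "poly (fix_poly d S)"
  have fin: "finite S" by (rule finite_permutes_subset[OF assms(2)])
  have c: "real (card S) > 0" using fin assms(3) by (simp add: card_gt_0_iff)
  obtain L where lim: "fixing_ratio d (wreath d S) \<longlonglongrightarrow> L" and L: "0 \<le> L" "L \<le> 1" "?f L = L"
    and max: "\<And>y. 0 \<le> y \<Longrightarrow> y \<le> 1 \<Longrightarrow> y \<le> ?f y \<Longrightarrow> y \<le> L"
  proof (rule monotone_iteration_limit)
    show "fixing_ratio d (wreath d S) 0 = 1" by (rule fixing_ratio_0[OF assms(2,3)])
    show "fixing_ratio d (wreath d S) (Suc n) = ?f (fixing_ratio d (wreath d S) n)" for n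
      by (rule fixing_ratio_Suc[OF assms(2,3)])
  qed (use fin assms(3) in \<open>auto simp: poly_fix_poly_0 poly_fix_poly_1_le poly_fix_poly_mono\<close>)
  have FPP: "FPP d (wreath d S) = L" unfolding FPP_def by (rule limI[OF lim])
  have conv: "convergent (fixing_ratio d (wreath d S))" using lim by (auto simp: convergent_def)
  have largest: "L \<in> {x \<in> {0..1}. ?f x = x} \<and> (\<forall>y\<in>{x \<in> {0..1}. ?f x = x}. y \<le> L)"
    using L max by auto
  have identity: "L = 1" if "?f = (\<lambda>x. x)" using max[of 1] L that by simp
  obtain P where P: "degree P \<le> d - 1" "\<And>i. coeff P i \<in> \<int>"
    "\<And>x. x * poly P x = card S * (?f x - x)"
    "id \<in> S \<Longrightarrow> coeff P (d - 1) = - ((-1) ^ d)"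
    using fix_poly_quotient[OF assms] by blast
  have root: "poly P L = 0" if "L \<noteq> 0" using P(3)[of L] L that by simp
  \<comment> \<open>\<open>P\<close> serves only when \<open>L\<close> is neither \<open>0\<close>
    nor \<open>1\<close>: \<open>L = 0\<close> need not be a root of \<open>P\<close>, and
    \<open>P\<close> is zero if the polynomial is the identity, where \<open>L = 1\<close>. In these
    two cases \<open>X - L\<close> works, its degree being at most \<open>d - 1\<close> because
    \<open>d \<ge> 2\<close>.\<close>
  obtain p :: "real poly" where p: "p \<noteq> 0" "degree p \<le> d - 1" "\<And>i. coeff p i \<in> \<int>" "poly p L = 0"
  proof (cases "L = 0 \<or> L = 1")
    case True
    have "degree [:- L, 1:] \<le> d - 1" using assms(1) by simp
    moreover have "coeff [:- L, 1:] i \<in> \<int>" for i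
      using True by (auto simp: coeff_pCons split: nat.split)
    ultimately show thesis using that[of "[:- L, 1:]"] by simp
  next
    case False
    have "P \<noteq> 0"
    proof
      assume "P = 0"
      then have "?f = (\<lambda>x. x)" using P(3) c by (simp add: fun_eq_iff)
      then show False using identity False by simp
    qed
    then show thesis using that P(1,2) root False by blast
  qed
  have integral: "algebraic_int L" if "id \<in> S"
  proof (cases "L = 0")
    case False
    \<comment> \<open>The sign turns the coefficient of degree \<open>d - 1\<close> into
      \<open>1\<close>; with the degree bound this makes \<open>?Q\<close> monic.\<close>
    let ?Q = "smult (- ((-1) ^ d)) P"
    have top: "coeff ?Q (d - 1) = 1" using P(4)[OF that] by (simp flip: power_add)
    then have "degree ?Q = d - 1"
      using P(1) by (intro antisym le_degree) auto
    then have "lead_coeff ?Q = 1" using top by simp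
    moreover have "\<forall>i. coeff ?Q i \<in> \<int>" using P(2) by simp
    moreover have "poly ?Q L = 0" using root False by simp
    ultimately show ?thesis by (rule algebraic_int.intros)
  qed simp
  have zero: "L = 0 \<longleftrightarrow> poly (pderiv (fix_poly d S)) 0 \<le> 1 \<and> ?f \<noteq> (\<lambda>x. x)"
  proof
    assume "L = 0"
    then have "?f \<noteq> (\<lambda>x. x)" using identity by auto
    moreover have "\<not> 1 < poly (pderiv (fix_poly d S)) 0"
    proof
      assume "1 < poly (pderiv (fix_poly d S)) 0"
      then obtain x where "0 < x" "x \<le> 1" "x \<le> ?f x" by (rule fix_poly_above_diagonal[OF fin])
      then show False using max[of x] \<open>L = 0\<close> by simp
    qed
    ultimately show "poly (pderiv (fix_poly d S)) 0 \<le> 1 \<and> ?f \<noteq> (\<lambda>x. x)" by simp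
  next
    assume "poly (pderiv (fix_poly d S)) 0 \<le> 1 \<and> ?f \<noteq> (\<lambda>x. x)"
    then show "L = 0" using fix_poly_identity[OF fin assms(3) _ L(2,3)] L(1) by (cases "L = 0") auto
  qed
  \<comment> \<open>If \<open>1\<close> is a fixed point, it is the largest one in the unit
    interval.\<close>
  have "L = 1 \<longleftrightarrow> ?f 1 = 1" using L max[of 1] by auto
  then have one: "L = 1 \<longleftrightarrow> (\<forall>s\<in>S. \<exists>i\<in>{1..d}. s i = i)"
    using poly_fix_poly_1_eq_1_iff[OF fin assms(3)] by simp
  have "\<exists>p :: real poly. p \<noteq> 0 \<and> degree p \<le> d - 1
      \<and> (\<forall>i. coeff p i \<in> int_adjoin (1 / real (card S))) \<and> poly p L = 0"
    using p Ints_subset_int_adjoin by (intro exI[of _ p]) auto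
  moreover have "algebraic L" by (rule algebraicI[OF p(3,1,4)])
  ultimately show ?thesis
    unfolding FPP using conv largest integral zero one by blast
qed

end
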